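(* Let $X$ be a Tychonoff space which is locally pseudocompact but not pseudocompact. Then for every ideal $I$ in $C(X)$ such that $X$ is $I$-pseudocompact, there exists an ideal $J$ in $C(X)$ such that $I\subsetneq J$ and $X$ is $J$-pseudocompact. Consequently, there exists a strictly increasing sequence of ideals $I_1\subsetneq I_2\subsetneq I_3\subsetneq\cdots$ of $C(X)$ such that $X$ is $I_n$-pseudocompact for each $n\in\mathbb N$.
   Context: $C(X)$ is the ring of all real-valued continuous functions on $X$. $Z(g)=\{x\in X:g(x)=0\}$ and $\bigcap Z[I]=\bigcap_{g\in I}Z(g)$. A subset $Y\subseteq X$ is bounded if every $f\in C(X)$ is bounded on $Y$. For an ideal $I$ in $C(X)$, $X$ is $I$-pseudocompact if $X\setminus\bigcap Z[I]$ is a bounded subset of $X$. $X$ is locally pseudocompact if every point of $X$ has a pseudocompact neighborhood. *)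

theory Defs
  imports "HOL-Analysis.Analysis" "HOL-Algebra.Ideal"
begin

definition tychonoff_space :: "'a topology \<Rightarrow> bool" where
  "tychonoff_space X \<longleftrightarrow> completely_regular_space X \<and> Hausdorff_space X"

text \<open>
  Functions are extensional on the carrier of the space, so that equality in the ring is
  equality of functions on \<open>topspace X\<close>.
\<close>

definition cont_ring :: "'a topology \<Rightarrow> ('a \<Rightarrow> real) ring" where
  "cont_ring X =
     \<lparr>carrier = {f \<in> extensional (topspace X). continuous_map X euclideanreal f},
      mult = (\<lambda>f g. \<lambda>x\<in>topspace X. f x * g x),
      one = (\<lambda>x\<in>topspace X. 1),
      zero = (\<lambda>x\<in>topspace X. 0),
      add = (\<lambda>f g. \<lambda>x\<in>topspace X. f x + g x)\<rparr>"

lemma continuous_map_restrict_topspace: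
  "continuous_map X Y (restrict f (topspace X)) \<longleftrightarrow> continuous_map X Y f"
  by (auto intro: continuous_map_eq)

lemma cring_cont_ring: "cring (cont_ring X)"
proof (intro cringI abelian_groupI comm_monoidI)
  fix f assume f: "f \<in> carrier (cont_ring X)"
  show "\<exists>g\<in>carrier (cont_ring X). g \<oplus>\<^bsub>cont_ring X\<^esub> f = \<zero>\<^bsub>cont_ring X\<^esub>"
  proof
    show "(\<lambda>x\<in>topspace X. - f x) \<in> carrier (cont_ring X)"
      using f by (simp add: cont_ring_def continuous_map_restrict_topspace)
    show "(\<lambda>x\<in>topspace X. - f x) \<oplus>\<^bsub>cont_ring X\<^esub> f = \<zero>\<^bsub>cont_ring X\<^esub>"
      by (auto simp: cont_ring_def fun_eq_iff)
  qed
qed (auto simp: cont_ring_def fun_eq_iff continuous_map_restrict_topspace extensional_def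
       algebra_simps intro!: continuous_map_add continuous_map_real_mult)

definition zero_set :: "'a topology \<Rightarrow> ('a \<Rightarrow> real) \<Rightarrow> 'a set" where
  "zero_set X g = {x \<in> topspace X. g x = 0}"

definition bounded_subset :: "'a topology \<Rightarrow> 'a set \<Rightarrow> bool" where
  "bounded_subset X Y \<longleftrightarrow>
     Y \<subseteq> topspace X \<and> (\<forall>f\<in>carrier (cont_ring X). bounded (f ` Y))"

definition pseudocompact_space :: "'a topology \<Rightarrow> bool" where
  "pseudocompact_space X \<longleftrightarrow> (\<forall>f\<in>carrier (cont_ring X). bounded (f ` topspace X))"

definition locally_pseudocompact_space :: "'a topology \<Rightarrow> bool" where
  "locally_pseudocompact_space X \<longleftrightarrow>
     (\<forall>x\<in>topspace X. \<exists>U N. openin X U \<and> x \<in> U \<and> U \<subseteq> N \<and> N \<subseteq> topspace X \<and>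
        pseudocompact_space (subtopology X N))"

definition ideal_pseudocompact_space :: "'a topology \<Rightarrow> ('a \<Rightarrow> real) set \<Rightarrow> bool" where
  "ideal_pseudocompact_space X I \<longleftrightarrow> bounded_subset X (topspace X - (\<Inter>g\<in>I. zero_set X g))"

text \<open>
  Ideals of \<open>cont_ring X\<close> are those of the library, so the whole ring counts as an ideal. If \<open>X\<close> is
  not pseudocompact, this makes no difference to ideals \<open>I\<close> for which \<open>X\<close> is \<open>I\<close>-pseudocompact:
\<close>

lemma ideal_pseudocompact_space_proper:
  assumes "\<not> pseudocompact_space X" and "ideal_pseudocompact_space X I"
  shows "I \<noteq> carrier (cont_ring X)"
proof
  assume I: "I = carrier (cont_ring X)"
  have "\<one>\<^bsub>cont_ring X\<^esub> \<in> I"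
    unfolding I by (simp add: cont_ring_def continuous_map_restrict_topspace)
  moreover have "zero_set X \<one>\<^bsub>cont_ring X\<^esub> = {}"
    by (auto simp: zero_set_def cont_ring_def)
  ultimately have "topspace X - (\<Inter>g\<in>I. zero_set X g) = topspace X"
    by blast
  with assms show False
    by (simp add: ideal_pseudocompact_space_def bounded_subset_def pseudocompact_space_def)
qed

end

theory Submission
  imports Defs
begin

text \<open>
  Write \<open>A = X - \<Inter>Z[I]\<close>. Bounded sets have bounded closure, so \<open>A\<close> is not dense in a space that
  is not pseudocompact. A point \<open>p\<close> off the closure of \<open>A\<close> has an open neighbourhood \<open>V\<close> that misses
  \<open>A\<close> and lies in a pseudocompact set, so \<open>A \<union> V\<close> is still bounded. The functions vanishing off
  \<open>A \<union> V\<close> form the ideal \<open>J\<close>, which contains \<open>I\<close>, and contains by complete regularity a function that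
  does not vanish at \<open>p\<close>, whereas all functions in \<open>I\<close> do.
\<close>

text \<open>Used with \<open>S\<close> the complement of a bounded set: each member is then nonzero
  only inside that set, so \<open>X\<close> is pseudocompact relative to this ideal.\<close>

definition vanishing_ideal :: "'a topology \<Rightarrow> 'a set \<Rightarrow> ('a \<Rightarrow> real) set" where
  "vanishing_ideal X S = {f \<in> carrier (cont_ring X). \<forall>x\<in>S. f x = 0}"

lemma ideal_vanishing_ideal:
  assumes S: "S \<subseteq> topspace X"
  shows "ideal (vanishing_ideal X S) (cont_ring X)"
proof -
  interpret cring "cont_ring X"
    by (rule cring_cont_ring)
  have zero: "\<zero>\<^bsub>cont_ring X\<^esub> x = 0" if "x \<in> S" for x
    using that S by (auto simp: cont_ring_def)
  have add: "(f \<oplus>\<^bsub>cont_ring X\<^esub> g) x = f x + g x"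
    and mult: "(f \<otimes>\<^bsub>cont_ring X\<^esub> g) x = f x * g x" if "x \<in> S" for f g x
    using that S by (auto simp: cont_ring_def)
  \<comment> \<open>The negative is given only abstractly, as an additive inverse in the ring, so
    its values are read off from the sum with \<open>f\<close> being zero.\<close>
  have minus: "(\<ominus>\<^bsub>cont_ring X\<^esub> f) x = - f x" if "f \<in> carrier (cont_ring X)" "x \<in> S" for f x
    using add[OF \<open>x \<in> S\<close>, of f "\<ominus>\<^bsub>cont_ring X\<^esub> f"] zero[OF \<open>x \<in> S\<close>] r_neg[OF that(1)] by simp
  show ?thesis
  proof (rule idealI[OF ring_axioms])
    show "subgroup (vanishing_ideal X S) (add_monoid (cont_ring X))"
      by (rule add.subgroupI)
        (auto simp: vanishing_ideal_def zero add minus simp flip: a_inv_def)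
  qed (auto simp: vanishing_ideal_def mult)
qed

lemma bounded_subset_Un:
  "bounded_subset X A \<Longrightarrow> bounded_subset X B \<Longrightarrow> bounded_subset X (A \<union> B)"
  by (auto simp: bounded_subset_def image_Un)

lemma bounded_subset_mono: "bounded_subset X B \<Longrightarrow> A \<subseteq> B \<Longrightarrow> bounded_subset X A"
  unfolding bounded_subset_def by (meson bounded_subset image_mono subset_trans)

text \<open>Continuity sends the closure of \<open>A\<close> into the closure of the image of
  \<open>A\<close>, and the closure of a bounded set of reals is bounded.\<close>

lemma bounded_subset_closure_of:
  assumes "bounded_subset X A"
  shows "bounded_subset X (X closure_of A)"
  unfolding bounded_subset_def
proof (intro conjI ballI)
  fix f assume f: "f \<in> carrier (cont_ring X)"
  then have "continuous_map X euclideanreal f"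
    by (simp add: cont_ring_def)
  then have "f ` (X closure_of A) \<subseteq> closure (f ` A)"
    using continuous_map_image_closure_subset by fastforce
  moreover have "bounded (closure (f ` A))"
    using assms f by (auto simp: bounded_subset_def)
  ultimately show "bounded (f ` (X closure_of A))"
    by (rule bounded_subset[rotated])
qed (rule closure_of_subset_topspace)

lemma bounded_subset_topspace: "bounded_subset X (topspace X) \<longleftrightarrow> pseudocompact_space X"
  by (simp add: bounded_subset_def pseudocompact_space_def)

text \<open>A continuous function on \<open>X\<close> stays continuous on \<open>N\<close>. It must
  be cut down to \<open>N\<close> by \<open>restrict\<close>, since ring elements are extensional on
  the carrier of their space.\<close>

lemma bounded_subset_pseudocompact:
  assumes N: "N \<subseteq> topspace X" and pc: "pseudocompact_space (subtopology X N)"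
  shows "bounded_subset X N"
  unfolding bounded_subset_def
proof (intro conjI ballI N)
  fix f assume "f \<in> carrier (cont_ring X)"
  then have "continuous_map (subtopology X N) euclideanreal f"
    by (simp add: cont_ring_def continuous_map_from_subtopology)
  then have "restrict f N \<in> carrier (cont_ring (subtopology X N))"
    using N continuous_map_restrict_topspace[of "subtopology X N" euclideanreal f]
    by (simp add: cont_ring_def Int_absorb1)
  then have "bounded (restrict f N ` topspace (subtopology X N))"
    using pc unfolding pseudocompact_space_def by blast
  then show "bounded (f ` N)"
    using N by (simp add: Int_absorb1)
qed

lemma ideal_pseudocompact_extension:
  assumes creg: "completely_regular_space X" and lpc: "locally_pseudocompact_space X"
    and npc: "\<not> pseudocompact_space X"
    and I: "ideal I (cont_ring X)" and Ipc: "ideal_pseudocompact_space X I"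
  shows "\<exists>J. ideal J (cont_ring X) \<and> I \<subset> J \<and> ideal_pseudocompact_space X J"
proof -
  define A where "A = topspace X - (\<Inter>g\<in>I. zero_set X g)"
  have A: "bounded_subset X A"
    using Ipc by (simp add: A_def ideal_pseudocompact_space_def)
  have "X closure_of A \<noteq> topspace X"
    using bounded_subset_closure_of[OF A] npc by (auto simp: bounded_subset_topspace)
  then obtain p where p: "p \<in> topspace X" "p \<notin> X closure_of A"
    using closure_of_subset_topspace[of X A] by blast
  obtain U N where U: "openin X U" "p \<in> U" "U \<subseteq> N" and N: "N \<subseteq> topspace X"
    "pseudocompact_space (subtopology X N)"
    using lpc p(1) unfolding locally_pseudocompact_space_def by meson
  define V where "V = U - X closure_of A"
  have V: "openin X V" "p \<in> V"
    using U p by (auto simp: V_def openin_diff)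
  have AV: "bounded_subset X (A \<union> V)"
  proof (rule bounded_subset_Un[OF A bounded_subset_mono])
    show "bounded_subset X N"
      by (rule bounded_subset_pseudocompact[OF N])
    show "V \<subseteq> N"
      using U(3) by (auto simp: V_def)
  qed
  define J where "J = vanishing_ideal X (topspace X - (A \<union> V))"
  have "ideal J (cont_ring X)"
    unfolding J_def by (rule ideal_vanishing_ideal) auto
  moreover have "ideal_pseudocompact_space X J"
    unfolding ideal_pseudocompact_space_def
    by (rule bounded_subset_mono[OF AV]) (auto simp: J_def vanishing_ideal_def zero_set_def)
  \<comment> \<open>A point off \<open>A\<close> lies in every zero set of \<open>I\<close>, so
    members of \<open>I\<close> vanish off \<open>A\<close>, hence off
    \<open>A \<union> V\<close>.\<close>
  moreover have "I \<subseteq> J"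
    using ideal.Icarr[OF I] by (auto simp: J_def vanishing_ideal_def A_def zero_set_def)
  moreover have "I \<noteq> J"
  proof -
    obtain f where f: "continuous_map X euclideanreal f" "f p = 0"
      "f ` (topspace X - V) \<subseteq> {1}"
      using creg V p(1) closedin_diff[OF closedin_topspace V(1)]
      unfolding completely_regular_space_alt by (metis Diff_iff)
    \<comment> \<open>Complete regularity yields the value 0 at \<open>p\<close> and 1 off
      \<open>V\<close>; subtracting from 1 swaps them, so that \<open>g\<close> vanishes off
      \<open>V\<close>.\<close>
    define g where "g = (\<lambda>x\<in>topspace X. 1 - f x)"
    have "g \<in> J"
      using f by (auto simp: J_def vanishing_ideal_def g_def cont_ring_def
          continuous_map_restrict_topspace intro!: continuous_map_diff)
    moreover have "g p = 1"
      using p f by (simp add: g_def)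
    moreover have "p \<notin> A"
      using p closure_of_subset[of A X] A by (auto simp: bounded_subset_def)
    ultimately show ?thesis
      using p(1) by (auto simp: A_def zero_set_def)
  qed
  ultimately show ?thesis by blast
qed

theorem theorem3p4:
  fixes X :: "'a topology"
  assumes "tychonoff_space X"
    and "locally_pseudocompact_space X"
    and "\<not> pseudocompact_space X"
  shows "(\<forall>I. ideal I (cont_ring X) \<and> ideal_pseudocompact_space X I \<longrightarrow>
            (\<exists>J. ideal J (cont_ring X) \<and> I \<subset> J \<and> ideal_pseudocompact_space X J))
       \<and> (\<exists>I :: nat \<Rightarrow> ('a \<Rightarrow> real) set.
            \<forall>n. ideal (I n) (cont_ring X) \<and> I n \<subset> I (Suc n) \<and>
                ideal_pseudocompact_space X (I n))"
proof (rule conjI)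
  show ext: "\<forall>I. ideal I (cont_ring X) \<and> ideal_pseudocompact_space X I \<longrightarrow>
            (\<exists>J. ideal J (cont_ring X) \<and> I \<subset> J \<and> ideal_pseudocompact_space X J)"
    using assms ideal_pseudocompact_extension[of X] by (auto simp: tychonoff_space_def)
  let ?P = "\<lambda>I. ideal I (cont_ring X) \<and> ideal_pseudocompact_space X I"
  \<comment> \<open>This is the zero ideal: its only member is the zero function, so the set that
    has to be bounded is empty. It shows that the chain can start.\<close>
  let ?Z = "vanishing_ideal X (topspace X)"
  have Z: "topspace X - (\<Inter>g\<in>?Z. zero_set X g) = {}"
    by (auto simp: vanishing_ideal_def zero_set_def)
  have "ideal_pseudocompact_space X ?Z"
    unfolding ideal_pseudocompact_space_def Z by (simp add: bounded_subset_def)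
  then have "\<exists>I. ?P I"
    using ideal_vanishing_ideal[OF subset_refl] by (intro exI[of _ ?Z] conjI)
  moreover have "\<exists>J. ?P J \<and> I \<subset> J" if "?P I" for I
    using ext[rule_format, OF that] by (elim exE conjE) (intro exI conjI)
  \<comment> \<open>Each extension is only known to exist, so the chain is built by dependent
    choice, with \<open>?P\<close> as the invariant.\<close>
  ultimately have "\<exists>I. \<forall>n. ?P (I n) \<and> I n \<subset> I (Suc n)"
    by (rule dependent_nat_choice)
  then show "\<exists>I :: nat \<Rightarrow> ('a \<Rightarrow> real) set.
            \<forall>n. ideal (I n) (cont_ring X) \<and> I n \<subset> I (Suc n) \<and>
                ideal_pseudocompact_space X (I n)"
    by (simp add: conj_ac)
qed

end
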